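(* Let $n\ge 1$, let $A_1,\dots,A_n$ be finite nonempty sets, and let $A_{\mathrm M}$ be the set of maps $\sigma$ on $[n]$ with $\sigma(i)\in A_i$ for all $i\in[n]$. For every $i\in[n]$ and $a\in A_i$ let $F(\cdot\,;i,a):\mathbb{R}^n\to\mathbb{R}$ be a map, and define $f^{(\sigma)},f:\mathbb{R}^n\to\mathbb{R}^n$ by $f^{(\sigma)}_i(v)=F(v;i,\sigma(i))$ and $f(v)=\min_{\sigma\in A_{\mathrm M}}f^{(\sigma)}(v)$. Let $\lambda\in[0,1)$ and assume that every map $f^{(\sigma)}$, $\sigma\in A_{\mathrm M}$, is order preserving and contracting in the sup-norm with contraction factor $\lambda$. Let $m_1$ be the cardinality of $\{(i,a)\mid i\in[n],\ a\in A_i\}$. Then the general policy iteration algorithm applied to $A_{\mathrm M}$, $f$, $(f^{(\sigma)})_{\sigma\in A_{\mathrm M}}$ stops after at most $s_{\max}$ iterations, where $$s_{\max}:=(m_1-n)\Bigl(1+\Bigl\lfloor\frac{\log(1-\lambda)}{\log\lambda}\Bigr\rfloor\Bigr).$$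
   Context: $[n]=\{1,\dots,n\}$; $\mathbb{R}^n$ carries the coordinatewise partial order and the sup-norm $\|v\|=\max_i|v_i|$. A self-map $g$ of $\mathbb{R}^n$ is order preserving if $v\le w$ implies $g(v)\le g(w)$, and contracting in the sup-norm with contraction factor $\lambda$ if $\|g(v)-g(w)\|\le\lambda\|v-w\|$ for all $v,w$. The minimum of vectors is taken in the coordinatewise order; here, for each $v$, it is attained by some $\sigma\in A_{\mathrm M}$ because $f^{(\sigma)}_i(v)$ depends on $\sigma$ only through $\sigma(i)$. General policy iteration algorithm. Input: a set $A_{\mathrm M}$ and self-maps $f$, $f^{(\sigma)}$ ($\sigma\in A_{\mathrm M}$) of $\mathbb{R}^n$ with $f(v)=\min_{\sigma}f^{(\sigma)}(v)$ (attained) for all $v$. (1) Set $s=0$ and choose an arbitrary $\sigma^0\in A_{\mathrm M}$. (2) Compute the fixed point $v^s$ of $f^{(\sigma^s)}$. (3) Choose $\sigma^{s+1}\in A_{\mathrm M}$ such that $f(v^s)=f^{(\sigma^{s+1})}(v^s)$, taking $\sigma^{s+1}=\sigma^s$ whenever this is possible. (4) If $\sigma^{s+1}=\sigma^s$, stop and return $v^s$ and $\sigma^s$; otherwise increment $s$ by one and go to (2). Convention: iterations are numbered by the index $s$, starting from $0$; "stops after at most $s_{\max}$ iterations" means that the value of $s$ at which the algorithm stops is at most $s_{\max}$. When $\lambda=0$ the quotient $\log(1-\lambda)/\log\lambda$ is read as $0$. *)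

theory Defs
  imports "HOL-Analysis.Analysis"
begin

text \<open>
  The index set \<open>[n]\<close> is a finite type \<open>'n\<close>, so that \<open>\<real>\<^sup>n\<close> is \<open>real ^ 'n\<close>. Its order
  \<open>\<le>\<close> is the coordinatewise one, \<^const>\<open>mono\<close> is order preservation, and \<^const>\<open>infnorm\<close> is the sup-norm.
\<close>

definition sup_norm_contracting :: "real \<Rightarrow> (real ^ 'n \<Rightarrow> real ^ 'n) \<Rightarrow> bool" where
  "sup_norm_contracting lam g \<longleftrightarrow> (\<forall>v w. infnorm (g v - g w) \<le> lam * infnorm (v - w))"

definition policies :: "('n \<Rightarrow> 'a set) \<Rightarrow> ('n \<Rightarrow> 'a) set" where
  "policies A = {\<sigma>. \<forall>i. \<sigma> i \<in> A i}"

definition policy_map ::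
  "(real ^ 'n \<Rightarrow> 'n \<Rightarrow> 'a \<Rightarrow> real) \<Rightarrow> ('n \<Rightarrow> 'a) \<Rightarrow> real ^ 'n \<Rightarrow> real ^ 'n" where
  "policy_map F \<sigma> v = (\<chi> i. F v i (\<sigma> i))"

text \<open>
  \<^const>\<open>Least\<close> on the partially ordered type \<open>real ^ 'n\<close> denotes the least element of a set
  of vectors, provided the set has one; \<open>min_map_attained\<close> below shows that it does here.
\<close>

definition min_map ::
  "('n \<Rightarrow> 'a set) \<Rightarrow> (real ^ 'n \<Rightarrow> 'n \<Rightarrow> 'a \<Rightarrow> real) \<Rightarrow> real ^ 'n \<Rightarrow> real ^ 'n" where
  "min_map A F v = (LEAST w. w \<in> (\<lambda>\<sigma>. policy_map F \<sigma> v) ` policies A)"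

lemma min_map_attained:
  fixes A :: "'n::finite \<Rightarrow> 'a set"
  assumes "\<And>i. finite (A i)" and "\<And>i. A i \<noteq> {}"
  shows "\<exists>\<sigma>\<in>policies A. min_map A F v = policy_map F \<sigma> v"
    and "\<forall>\<sigma>\<in>policies A. min_map A F v \<le> policy_map F \<sigma> v"
proof -
  have "\<forall>i. \<exists>a\<in>A i. \<forall>b\<in>A i. F v i a \<le> F v i b"
    using assms by (metis arg_min_if_finite(1) arg_min_least)
  then obtain \<tau> where \<tau>: "\<forall>i. \<tau> i \<in> A i \<and> (\<forall>b\<in>A i. F v i (\<tau> i) \<le> F v i b)"
    by metis
  then have mem: "\<tau> \<in> policies A"
    and le: "\<forall>\<sigma>\<in>policies A. policy_map F \<tau> v \<le> policy_map F \<sigma> v"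
    by (auto simp: policies_def policy_map_def less_eq_vec_def)
  then have "min_map A F v = policy_map F \<tau> v"
    unfolding min_map_def by (intro Least_equality) auto
  with mem le show "\<exists>\<sigma>\<in>policies A. min_map A F v = policy_map F \<sigma> v"
    and "\<forall>\<sigma>\<in>policies A. min_map A F v \<le> policy_map F \<sigma> v"
    by auto
qed

definition is_the_fixed_point :: "('v \<Rightarrow> 'v) \<Rightarrow> 'v \<Rightarrow> bool" where
  "is_the_fixed_point g v \<longleftrightarrow> g v = v \<and> (\<forall>w. g w = w \<longrightarrow> w = v)"

text \<open>
  Policy iteration leaves the choice of policies open, so it is modelled as a transition
  relation on configurations. \<open>Evaluate s \<sigma>\<close> is the configuration before the fixed point
  \<open>v\<^sup>s\<close> is computed, \<open>Improve s \<sigma> v\<close> the one before \<open>\<sigma>\<^bsup>s+1\<^esup>\<close> is chosen, and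
  \<open>Stopped s \<sigma> v\<close> says that the algorithm has stopped at index \<open>s\<close> and returned \<open>v\<close>, \<open>\<sigma>\<close>.
\<close>

datatype ('p, 'v) pi_config =
    Start
  | Evaluate nat 'p
  | Improve nat 'p 'v
  | Stopped nat 'p 'v

inductive pi_step ::
  "'p set \<Rightarrow> ('v \<Rightarrow> 'v) \<Rightarrow> ('p \<Rightarrow> 'v \<Rightarrow> 'v) \<Rightarrow> ('p, 'v) pi_config \<Rightarrow> ('p, 'v) pi_config \<Rightarrow> bool"
  for AM f fs where
  init: "\<sigma> \<in> AM \<Longrightarrow> pi_step AM f fs Start (Evaluate 0 \<sigma>)"
| evaluate: "is_the_fixed_point (fs \<sigma>) v \<Longrightarrow> pi_step AM f fs (Evaluate s \<sigma>) (Improve s \<sigma> v)"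
| improve: "\<lbrakk>\<sigma>' \<in> AM; f v = fs \<sigma>' v; f v = fs \<sigma> v \<longrightarrow> \<sigma>' = \<sigma>\<rbrakk> \<Longrightarrow>
    pi_step AM f fs (Improve s \<sigma> v)
      (if \<sigma>' = \<sigma> then Stopped s \<sigma> v else Evaluate (Suc s) \<sigma>')"

text \<open>
  Every way of running the algorithm from the given configuration reaches, after finitely many
  transitions and without getting stuck, a configuration \<open>Stopped s \<sigma> v\<close> with \<open>s \<le> N\<close>.
\<close>

inductive stops_within ::
  "'p set \<Rightarrow> ('v \<Rightarrow> 'v) \<Rightarrow> ('p \<Rightarrow> 'v \<Rightarrow> 'v) \<Rightarrow> int \<Rightarrow> ('p, 'v) pi_config \<Rightarrow> bool"
  for AM f fs N where
  stopped: "int s \<le> N \<Longrightarrow> stops_within AM f fs N (Stopped s \<sigma> v)"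
| running: "\<lbrakk>\<exists>c'. pi_step AM f fs c c'; \<And>c'. pi_step AM f fs c c' \<Longrightarrow> stops_within AM f fs N c'\<rbrakk>
    \<Longrightarrow> stops_within AM f fs N c"

definition policy_iteration_stops_within ::
  "'p set \<Rightarrow> ('v \<Rightarrow> 'v) \<Rightarrow> ('p \<Rightarrow> 'v \<Rightarrow> 'v) \<Rightarrow> int \<Rightarrow> bool" where
  "policy_iteration_stops_within AM f fs N \<longleftrightarrow> stops_within AM f fs N Start"

text \<open>The value \<open>0\<close> of the quotient at \<open>lam = 0\<close> is a convention.\<close>

definition log_quotient :: "real \<Rightarrow> real" where
  "log_quotient lam = (if lam = 0 then 0 else ln (1 - lam) / ln lam)"

definition s_max :: "('n::finite \<Rightarrow> 'a set) \<Rightarrow> real \<Rightarrow> int" where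
  "s_max A lam =
     (int (card {(i, a). a \<in> A i}) - int CARD('n)) * (1 + \<lfloor>log_quotient lam\<rfloor>)"

end

theory Submission
  imports Defs
begin

text \<open>
  Let \<open>w\<close> be the fixed point of \<open>f\<close>. The iterates satisfy \<open>w \<le> v\<^bsup>t+1\<^esup> \<le> f(v\<^sup>t)\<close>, so the error
  \<open>\<parallel>v\<^sup>t - w\<parallel>\<close> shrinks by the factor \<open>lam\<close> in each iteration. If the algorithm does not stop at \<open>t\<close>,
  then \<open>e = f\<^bsup>(\<sigma>\<^sup>t)\<^esup>(w) - w\<close> is nonnegative and nonzero, and \<open>(1 - lam) \<parallel>v\<^sup>t - w\<parallel> \<le> \<parallel>e\<parallel>\<close>. Choose
  \<open>i\<close> with \<open>e\<^sub>i = \<parallel>e\<parallel>\<close>. If the pair \<open>(i, \<sigma>\<^sup>t(i))\<close> is used again at \<open>t + d\<close>, then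
  \<open>e\<^sub>i \<le> v\<^bsup>t+d\<^esup>\<^sub>i - w\<^sub>i \<le> lam\<^sup>d \<parallel>v\<^sup>t - w\<parallel>\<close>, which forces \<open>1 - lam \<le> lam\<^sup>d\<close>, that is,
  \<open>d \<le> log (1 - lam) / log lam\<close>. Hence every \<open>1 + \<lfloor>log (1 - lam) / log lam\<rfloor>\<close> iterations some pair
  disappears for good, and when only \<open>n\<close> pairs are left there is a single policy.
\<close>

section \<open>The sup-norm in coordinates\<close>

lemma infnorm_cart_Max:
  fixes x :: "real ^ 'n"
  shows "infnorm x = (MAX i. \<bar>x $ i\<bar>)"
  unfolding infnorm_cart by (subst cSup_eq_Max) (auto simp: full_SetCompr_eq)

lemma infnorm_le_cart_iff:
  fixes x :: "real ^ 'n"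
  shows "infnorm x \<le> c \<longleftrightarrow> (\<forall>i. \<bar>x $ i\<bar> \<le> c)"
  by (simp add: infnorm_cart_Max)

lemma infnorm_attained_cart:
  fixes x :: "real ^ 'n"
  obtains i where "infnorm x = \<bar>x $ i\<bar>"
proof -
  have "(MAX i. \<bar>x $ i\<bar>) \<in> range (\<lambda>i. \<bar>x $ i\<bar>)"
    by (rule Max_in) auto
  then show ?thesis using that by (metis imageE infnorm_cart_Max)
qed

lemma infnorm_mono_cart:
  fixes x y :: "real ^ 'n"
  assumes "0 \<le> x" "x \<le> y"
  shows "infnorm x \<le> infnorm y"
  unfolding infnorm_le_cart_iff
proof
  fix i
  have "0 \<le> x $ i" "x $ i \<le> y $ i" using assms by (auto simp: less_eq_vec_def)
  then show "\<bar>x $ i\<bar> \<le> infnorm y" using component_le_infnorm_cart[of y i] by linarith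
qed

section \<open>Sup-norm contractions: fixed points and comparison\<close>

lemma sup_norm_contractingD:
  "sup_norm_contracting lam g \<Longrightarrow> infnorm (g v - g w) \<le> lam * infnorm (v - w)"
  by (simp add: sup_norm_contracting_def)

lemma sup_norm_contracting_funpow:
  assumes "sup_norm_contracting lam g" "0 \<le> lam"
  shows "sup_norm_contracting (lam ^ k) (g ^^ k)"
proof (induction k)
  case 0
  then show ?case by (simp add: sup_norm_contracting_def)
next
  case (Suc k)
  show ?case unfolding sup_norm_contracting_def
  proof (intro allI)
    fix v w
    have "infnorm ((g ^^ Suc k) v - (g ^^ Suc k) w)
        \<le> lam * infnorm ((g ^^ k) v - (g ^^ k) w)"
      using sup_norm_contractingD[OF assms(1)] by simp
    also have "\<dots> \<le> lam * (lam ^ k * infnorm (v - w))"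
      using sup_norm_contractingD[OF Suc] assms(2) by (intro mult_left_mono)
    finally show "infnorm ((g ^^ Suc k) v - (g ^^ Suc k) w) \<le> lam ^ Suc k * infnorm (v - w)"
      by (simp add: mult.assoc)
  qed
qed

text \<open>
  The library's Banach theorem is about the Euclidean norm, in which only a sufficiently high
  iterate of \<open>g\<close> is known to be a contraction.
\<close>

lemma sup_norm_contracting_fixed_point:
  fixes g :: "real ^ 'n \<Rightarrow> real ^ 'n"
  assumes g: "sup_norm_contracting lam g" and lam: "0 \<le> lam" "lam < 1"
  obtains v where "is_the_fixed_point g v"
proof -
  define C where "C = sqrt (real DIM(real ^ 'n))"
  have C: "C > 0" by (simp add: C_def)
  \<comment> \<open>\<open>C\<close> bounds the Euclidean norm by the sup-norm, so
    \<open>C * lam ^ k < 1\<close> makes \<open>g ^^ k\<close> a Euclidean contraction.\<close>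
  obtain k where k: "lam ^ k < 1 / C"
    using real_arch_pow_inv[of "1 / C" lam] C lam by auto
  have "dist ((g ^^ k) x) ((g ^^ k) y) \<le> (C * lam ^ k) * dist x y" for x y
  proof -
    have "dist ((g ^^ k) x) ((g ^^ k) y) \<le> C * infnorm ((g ^^ k) x - (g ^^ k) y)"
      unfolding dist_norm C_def by (rule norm_le_infnorm)
    also have "\<dots> \<le> C * (lam ^ k * infnorm (x - y))"
      using C sup_norm_contractingD[OF sup_norm_contracting_funpow[OF g lam(1)]]
      by (intro mult_left_mono) auto
    also have "\<dots> \<le> C * (lam ^ k * dist x y)"
      unfolding dist_norm using C lam
      by (intro mult_left_mono infnorm_le_norm) auto
    finally show ?thesis by (simp add: mult.assoc)
  qed
  then have "\<exists>!x. (g ^^ k) x = x"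
    using C k lam
    by (intro banach_fix_type[where c = "C * lam ^ k"]) (auto simp: field_simps)
  then obtain v where v: "(g ^^ k) v = v" and uniq: "\<And>x. (g ^^ k) x = x \<Longrightarrow> x = v"
    by auto
  \<comment> \<open>\<open>g\<close> commutes with \<open>g ^^ k\<close>, hence permutes its fixed
    points, and there is only one.\<close>
  have "(g ^^ k) (g v) = g v" using v by (simp add: funpow_swap1[symmetric])
  then have "g v = v" by (rule uniq)
  moreover have "x = v" if "g x = x" for x
    by (rule uniq) (induction k, auto simp: that)
  ultimately show ?thesis using that by (auto simp: is_the_fixed_point_def)
qed

text \<open>If the largest entry \<open>d\<close> of \<open>y - x\<close> were positive, shifting
  \<open>x\<close> up by \<open>d\<close> in every coordinate would give
  \<open>y \<le> g y \<le> g (x + d) \<le> x + lam * d\<close>. Where \<open>d\<close> is attained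
  this reads \<open>d \<le> lam * d\<close>, which is impossible.\<close>

lemma mono_contracting_comparison:
  fixes g :: "real ^ 'n \<Rightarrow> real ^ 'n"
  assumes mono: "mono g" and g: "sup_norm_contracting lam g" and lam: "0 \<le> lam" "lam < 1"
    and sub: "y \<le> g y" and super: "g x \<le> x"
  shows "y \<le> x"
proof -
  define d where "d = (MAX i. y $ i - x $ i)"
  have "d \<in> range (\<lambda>i. y $ i - x $ i)" unfolding d_def by (rule Max_in) auto
  then obtain j where j: "d = y $ j - x $ j" by auto
  have le: "y $ i - x $ i \<le> d" for i unfolding d_def by (rule Max_ge) auto
  have "d \<le> 0"
  proof (rule ccontr)
    assume d: "\<not> d \<le> 0"
    define z where "z = x + (\<chi> i. d)"
    have "y \<le> z" using le by (auto simp: z_def less_eq_vec_def algebra_simps)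
    then have "g y \<le> g z" using mono by (auto dest: monoD)
    then have "y $ j \<le> g z $ j"
      using sub by (meson less_eq_vec_def order_trans)
    moreover have "\<bar>(g z - g x) $ j\<bar> \<le> lam * d"
    proof -
      have "infnorm (z - x) \<le> d" using d by (auto simp: infnorm_le_cart_iff z_def)
      then have "infnorm (g z - g x) \<le> lam * d"
        using sup_norm_contractingD[OF g, of z x] lam by (meson mult_left_mono order_trans)
      then show ?thesis by (simp add: infnorm_le_cart_iff)
    qed
    moreover have "g x $ j \<le> x $ j" using super by (simp add: less_eq_vec_def)
    moreover have "lam * d < 1 * d" using d lam by (intro mult_strict_right_mono) auto
    ultimately show False using j by auto
  qed
  then show ?thesis
    using le by (auto simp: less_eq_vec_def) (meson diff_le_0_iff_le order_trans)
qed

section \<open>The logarithm quotient\<close>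

lemma log_quotient_nonneg:
  assumes "0 \<le> lam" "lam < 1"
  shows "0 \<le> log_quotient lam"
  using assms by (auto simp: log_quotient_def intro!: divide_nonpos_nonpos)

lemma le_floor_log_quotient:
  assumes lam: "0 \<le> lam" "lam < 1" and d: "1 - lam \<le> lam ^ d"
  shows "int d \<le> \<lfloor>log_quotient lam\<rfloor>"
proof (cases "lam = 0")
  case True
  \<comment> \<open>Here \<open>0 ^ d \<ge> 1\<close> forces \<open>d = 0\<close>, in line with the
    convention for the quotient.\<close>
  with d show ?thesis by (cases d) (auto simp: log_quotient_def)
next
  case False
  with lam have pos: "0 < lam" "ln lam < 0" by auto
  have "ln (1 - lam) \<le> ln (lam ^ d)" using d lam pos by simp
  also have "\<dots> = real d * ln lam" using pos by (simp add: ln_realpow)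
  finally show ?thesis
    using False pos by (simp add: log_quotient_def le_floor_iff le_divide_eq)
qed

section \<open>The minimum map and its fixed point\<close>

locale contracting_policies =
  fixes A :: "'n::finite \<Rightarrow> 'a set"
    and F :: "real ^ 'n \<Rightarrow> 'n \<Rightarrow> 'a \<Rightarrow> real"
    and lam :: real
  assumes finite_A: "\<And>i. finite (A i)"
    and nonempty_A: "\<And>i. A i \<noteq> {}"
    and lam: "0 \<le> lam" "lam < 1"
    and mono: "\<And>\<sigma>. \<sigma> \<in> policies A \<Longrightarrow> mono (policy_map F \<sigma>)"
    and contr: "\<And>\<sigma>. \<sigma> \<in> policies A \<Longrightarrow> sup_norm_contracting lam (policy_map F \<sigma>)"
begin

abbreviation f :: "real ^ 'n \<Rightarrow> real ^ 'n" where
  "f \<equiv> min_map A F"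

lemma min_map_le: "\<sigma> \<in> policies A \<Longrightarrow> f v \<le> policy_map F \<sigma> v"
  using min_map_attained(2)[of A, OF finite_A nonempty_A] by blast

lemma min_map_attainedE:
  obtains \<sigma> where "\<sigma> \<in> policies A" "f v = policy_map F \<sigma> v"
  using min_map_attained(1)[of A, OF finite_A nonempty_A] by blast

text \<open>A policy attaining the minimum at \<open>w\<close> bounds \<open>f\<close> from above at
  \<open>v\<close>, so \<open>f v - f w\<close> is at most the difference under this single policy.
  Exchanging \<open>v\<close> and \<open>w\<close> gives the absolute value.\<close>

lemma min_map_contracting: "sup_norm_contracting lam f"
proof -
  have *: "(f v - f w) $ i \<le> lam * infnorm (v - w)" for v w i
  proof -
    obtain \<tau> where \<tau>: "\<tau> \<in> policies A" "f w = policy_map F \<tau> w" by (rule min_map_attainedE)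
    then have "(f v - f w) $ i \<le> (policy_map F \<tau> v - policy_map F \<tau> w) $ i"
      using min_map_le[OF \<tau>(1), of v] by (auto simp: less_eq_vec_def)
    also have "\<dots> \<le> infnorm (policy_map F \<tau> v - policy_map F \<tau> w)"
      using component_le_infnorm_cart abs_le_D1 by blast
    also have "\<dots> \<le> lam * infnorm (v - w)" using contr[OF \<tau>(1)] by (rule sup_norm_contractingD)
    finally show ?thesis .
  qed
  show ?thesis
    unfolding sup_norm_contracting_def infnorm_le_cart_iff
  proof (intro allI)
    fix v w i
    show "\<bar>(f v - f w) $ i\<bar> \<le> lam * infnorm (v - w)"
      using *[of v w i] *[of w v i] by (auto simp: infnorm_sub abs_le_iff)
  qed
qed

text \<open>The vector \<open>w\<close> of the overview. The choice is unambiguous, since a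
  contraction has at most one fixed point.\<close>

definition opt :: "real ^ 'n" where
  "opt = (SOME w. f w = w)"

lemma f_opt: "f opt = opt"
proof -
  obtain w where "is_the_fixed_point f w"
    using sup_norm_contracting_fixed_point[OF min_map_contracting lam] .
  then have "f w = w" by (simp add: is_the_fixed_point_def)
  then show ?thesis unfolding opt_def by (rule someI)
qed

lemma opt_le_policy_map: "\<sigma> \<in> policies A \<Longrightarrow> opt \<le> policy_map F \<sigma> opt"
  using min_map_le f_opt by metis

section \<open>Values of policies, their errors, and runs of the algorithm\<close>

definition val :: "('n \<Rightarrow> 'a) \<Rightarrow> real ^ 'n" where
  "val \<sigma> = (THE v. is_the_fixed_point (policy_map F \<sigma>) v)"

lemma is_the_fixed_point_iff_val:
  assumes "\<sigma> \<in> policies A"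
  shows "is_the_fixed_point (policy_map F \<sigma>) v \<longleftrightarrow> v = val \<sigma>"
proof -
  obtain w where w: "is_the_fixed_point (policy_map F \<sigma>) w"
    using sup_norm_contracting_fixed_point[OF contr[OF assms] lam] .
  then have "is_the_fixed_point (policy_map F \<sigma>) x \<longleftrightarrow> x = w" for x
    by (auto simp: is_the_fixed_point_def)
  then show ?thesis by (simp add: val_def)
qed

lemma policy_map_val: "\<sigma> \<in> policies A \<Longrightarrow> policy_map F \<sigma> (val \<sigma>) = val \<sigma>"
  using is_the_fixed_point_iff_val by (auto simp: is_the_fixed_point_def)

lemma opt_le_val: "\<sigma> \<in> policies A \<Longrightarrow> opt \<le> val \<sigma>"
  using mono_contracting_comparison[OF mono contr lam opt_le_policy_map] policy_map_val by simp

definition gap :: "('n \<Rightarrow> 'a) \<Rightarrow> real" where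
  "gap \<sigma> = infnorm (policy_map F \<sigma> opt - opt)"

text \<open>Triangle inequality through \<open>policy_map F \<sigma> opt\<close>: the first part
  contracts and the second is the gap.\<close>

lemma error_le_gap:
  assumes "\<sigma> \<in> policies A"
  shows "(1 - lam) * infnorm (val \<sigma> - opt) \<le> gap \<sigma>"
proof -
  have "infnorm (val \<sigma> - opt) = infnorm ((policy_map F \<sigma> (val \<sigma>) - policy_map F \<sigma> opt)
      + (policy_map F \<sigma> opt - opt))"
    using policy_map_val[OF assms] by simp
  also have "\<dots> \<le> infnorm (policy_map F \<sigma> (val \<sigma>) - policy_map F \<sigma> opt) + gap \<sigma>"
    unfolding gap_def by (rule infnorm_triangle)
  also have "\<dots> \<le> lam * infnorm (val \<sigma> - opt) + gap \<sigma>"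
    using sup_norm_contractingD[OF contr[OF assms]] by simp
  finally show ?thesis by (simp add: algebra_simps)
qed

text \<open>Greediness gives
  \<open>policy_map F \<sigma>' (val \<sigma>) \<le> val \<sigma>\<close>, so
  \<open>val \<sigma>' \<le> val \<sigma>\<close> by comparison. One application of the map of
  \<open>\<sigma>'\<close> sharpens this to \<open>val \<sigma>' \<le> f (val \<sigma>)\<close>,
  which squeezes the new error between \<open>0\<close> and
  \<open>f (val \<sigma>) - f opt\<close>.\<close>

lemma improvement:
  assumes \<sigma>: "\<sigma> \<in> policies A" and \<sigma>': "\<sigma>' \<in> policies A"
    and greedy: "f (val \<sigma>) = policy_map F \<sigma>' (val \<sigma>)"
  shows "infnorm (val \<sigma>' - opt) \<le> lam * infnorm (val \<sigma> - opt)"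
proof -
  have "policy_map F \<sigma>' (val \<sigma>) \<le> val \<sigma>"
    using min_map_le[OF \<sigma>, of "val \<sigma>"] policy_map_val[OF \<sigma>] greedy by simp
  then have "val \<sigma>' \<le> val \<sigma>"
    using mono_contracting_comparison[OF mono contr lam] \<sigma>' policy_map_val by simp
  with mono[OF \<sigma>'] have "policy_map F \<sigma>' (val \<sigma>') \<le> policy_map F \<sigma>' (val \<sigma>)" by (rule monoD)
  then have "val \<sigma>' - opt \<le> f (val \<sigma>) - f opt"
    using policy_map_val[OF \<sigma>'] greedy f_opt by (simp add: less_eq_vec_def)
  moreover have "0 \<le> val \<sigma>' - opt" using opt_le_val[OF \<sigma>'] by (simp add: less_eq_vec_def)
  ultimately have "infnorm (val \<sigma>' - opt) \<le> infnorm (f (val \<sigma>) - f opt)"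
    by (rule infnorm_mono_cart[rotated])
  also have "\<dots> \<le> lam * infnorm (val \<sigma> - opt)"
    using min_map_contracting by (rule sup_norm_contractingD)
  finally show ?thesis .
qed

text \<open>The policies \<open>\<sigma>\<^sup>0, \<dots>, \<sigma>\<^sup>s\<close> of a run that has not stopped before index \<open>s\<close>.\<close>

definition run :: "(nat \<Rightarrow> 'n \<Rightarrow> 'a) \<Rightarrow> nat \<Rightarrow> bool" where
  "run \<sigma> s \<longleftrightarrow> (\<forall>t\<le>s. \<sigma> t \<in> policies A) \<and> (\<forall>t<s.
     f (val (\<sigma> t)) = policy_map F (\<sigma> (Suc t)) (val (\<sigma> t)) \<and> f (val (\<sigma> t)) \<noteq> val (\<sigma> t))"

lemma runD:
  assumes "run \<sigma> s"
  shows "t \<le> s \<Longrightarrow> \<sigma> t \<in> policies A"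
    and "t < s \<Longrightarrow> f (val (\<sigma> t)) = policy_map F (\<sigma> (Suc t)) (val (\<sigma> t))"
    and "t < s \<Longrightarrow> f (val (\<sigma> t)) \<noteq> val (\<sigma> t)"
  using assms by (auto simp: run_def)

lemma run_error_decay:
  assumes "run \<sigma> s" "t + d \<le> s"
  shows "infnorm (val (\<sigma> (t + d)) - opt) \<le> lam ^ d * infnorm (val (\<sigma> t) - opt)"
  using assms(2)
proof (induction d)
  case 0
  then show ?case by simp
next
  case (Suc d)
  have "infnorm (val (\<sigma> (t + Suc d)) - opt) \<le> lam * infnorm (val (\<sigma> (t + d)) - opt)"
    using Suc.prems runD[OF assms(1)] by (intro improvement) auto
  also have "\<dots> \<le> lam * (lam ^ d * infnorm (val (\<sigma> t) - opt))"
    using Suc lam by (intro mult_left_mono) auto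
  finally show ?case by (simp add: mult.assoc)
qed

lemma action_eliminated:
  assumes r: "run \<sigma> s" and t: "t < s"
  obtains i where "\<And>d. t + d \<le> s \<Longrightarrow> \<sigma> (t + d) i = \<sigma> t i \<Longrightarrow> int d \<le> \<lfloor>log_quotient lam\<rfloor>"
proof -
  note \<sigma>t = runD(1)[OF r less_imp_le[OF t]]
  obtain i where i: "gap (\<sigma> t) = \<bar>(policy_map F (\<sigma> t) opt - opt) $ i\<bar>"
    unfolding gap_def by (rule infnorm_attained_cart)
  have gap_i: "gap (\<sigma> t) = F opt i (\<sigma> t i) - opt $ i"
    using i opt_le_policy_map[OF \<sigma>t] by (auto simp: policy_map_def less_eq_vec_def)
  \<comment> \<open>\<open>f\<close> fixes \<open>opt\<close> but not
    \<open>val (\<sigma> t)\<close>. The positive error can be cancelled at the end.\<close>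
  have "val (\<sigma> t) \<noteq> opt" using runD(3)[OF r t] f_opt by auto
  then have err: "infnorm (val (\<sigma> t) - opt) > 0" by (simp add: infnorm_pos_lt)
  have "int d \<le> \<lfloor>log_quotient lam\<rfloor>" if d: "t + d \<le> s" and same: "\<sigma> (t + d) i = \<sigma> t i" for d
  proof -
    let ?\<tau> = "\<sigma> (t + d)"
    have \<tau>: "?\<tau> \<in> policies A" using runD(1)[OF r d] .
    \<comment> \<open>At coordinate \<open>i\<close> the policies \<open>?\<tau>\<close> and
      \<open>\<sigma> t\<close> use the same action, so the gap of \<open>\<sigma> t\<close> is
      bounded by the error of \<open>?\<tau>\<close>.\<close>
    have "policy_map F ?\<tau> opt \<le> policy_map F ?\<tau> (val ?\<tau>)"
      using mono[OF \<tau>] opt_le_val[OF \<tau>] by (rule monoD)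
    then have "policy_map F ?\<tau> opt $ i \<le> val ?\<tau> $ i"
      using policy_map_val[OF \<tau>] by (simp add: less_eq_vec_def)
    then have "gap (\<sigma> t) \<le> (val ?\<tau> - opt) $ i"
      using gap_i same by (simp add: policy_map_def)
    also have "\<dots> \<le> infnorm (val ?\<tau> - opt)"
      using component_le_infnorm_cart abs_le_D1 by blast
    also have "\<dots> \<le> lam ^ d * infnorm (val (\<sigma> t) - opt)" using r d by (rule run_error_decay)
    finally have "(1 - lam) * infnorm (val (\<sigma> t) - opt) \<le> lam ^ d * infnorm (val (\<sigma> t) - opt)"
      using error_le_gap[OF \<sigma>t] by linarith
    then have "1 - lam \<le> lam ^ d" using err by simp
    with lam show ?thesis by (rule le_floor_log_quotient)
  qed
  then show ?thesis using that by blast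
qed

section \<open>Counting the pairs still in use\<close>

definition pairs :: "('n \<times> 'a) set" where
  "pairs = {(i, a). a \<in> A i}"

lemma finite_pairs: "finite pairs"
proof -
  have "pairs = Sigma UNIV A" by (auto simp: pairs_def)
  then show ?thesis using finite_A by auto
qed

abbreviation graph :: "('n \<Rightarrow> 'a) \<Rightarrow> ('n \<times> 'a) set" where
  "graph \<sigma> \<equiv> range (\<lambda>i. (i, \<sigma> i))"

lemma card_graph: "card (graph \<sigma>) = CARD('n)"
  by (simp add: card_image inj_on_def)

lemma graph_subset_pairs: "\<sigma> \<in> policies A \<Longrightarrow> graph \<sigma> \<subseteq> pairs"
  by (auto simp: pairs_def policies_def)

lemma card_pairs_ge: "CARD('n) \<le> card pairs"
proof -
  obtain \<sigma> where "\<sigma> \<in> policies A" by (rule min_map_attainedE)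
  then show ?thesis using card_mono[OF finite_pairs graph_subset_pairs] card_graph by metis
qed

text \<open>Both factors are nonnegative, so truncated subtraction and \<open>nat\<close> lose
  nothing and the counting can be done in the natural numbers.\<close>

lemma s_max_eq: "s_max A lam = int ((card pairs - CARD('n)) * Suc (nat \<lfloor>log_quotient lam\<rfloor>))"
  using card_pairs_ge log_quotient_nonneg[OF lam]
  by (simp add: s_max_def pairs_def[symmetric] of_nat_diff of_nat_mult del: mult_Suc_right)

lemma run_length:
  assumes r: "run \<sigma> s"
  shows "int s \<le> s_max A lam"
proof (rule ccontr)
  define K where "K = card pairs - CARD('n)"
  define p where "p = Suc (nat \<lfloor>log_quotient lam\<rfloor>)"
  \<comment> \<open>The pairs chosen at some index from \<open>t\<close> to \<open>s\<close>; this
    set shrinks as \<open>t\<close> grows.\<close>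
  define used where "used t = (\<Union>t'\<in>{t..s}. graph (\<sigma> t'))" for t
  assume "\<not> int s \<le> s_max A lam"
  then have Ks: "K * p < s"
    unfolding s_max_eq K_def p_def by (simp only: of_nat_le_iff not_le)
  have mem_used: "(i, a) \<in> used t \<longleftrightarrow> (\<exists>t'. t \<le> t' \<and> t' \<le> s \<and> \<sigma> t' i = a)" for i a t
    by (force simp: used_def image_iff)
  have used_pairs: "used t \<subseteq> pairs" for t
    using graph_subset_pairs runD(1)[OF r] by (force simp: used_def)
  then have fin: "finite (used t)" for t using finite_pairs finite_subset by blast
  \<comment> \<open>Each block of \<open>p\<close> iterations loses at least one pair for
    good.\<close>
  have "card (used (k * p)) + k \<le> card pairs" if "k \<le> K" for k
    using that
  proof (induction k)
    case 0
    show ?case using card_mono[OF finite_pairs used_pairs] by simp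
  next
    case (Suc k)
    have "k * p \<le> K * p" using Suc.prems by (intro mult_le_mono1) auto
    with Ks have kp: "k * p < s" by linarith
    obtain i where i: "\<And>d. k * p + d \<le> s \<Longrightarrow> \<sigma> (k * p + d) i = \<sigma> (k * p) i \<Longrightarrow>
        int d \<le> \<lfloor>log_quotient lam\<rfloor>"
      using action_eliminated[OF r kp] by blast
    have "(i, \<sigma> (k * p) i) \<notin> used (Suc k * p)"
    proof
      assume "(i, \<sigma> (k * p) i) \<in> used (Suc k * p)"
      then obtain t where t: "Suc k * p \<le> t" "t \<le> s" "\<sigma> t i = \<sigma> (k * p) i"
        by (auto simp: used_def)
      \<comment> \<open>The pair would recur at distance at least \<open>p\<close>, one more than
        elimination permits.\<close>
      then have "int (t - k * p) \<le> \<lfloor>log_quotient lam\<rfloor>" by (intro i) auto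
      moreover have "p \<le> t - k * p" using t(1) by simp
      moreover have "\<lfloor>log_quotient lam\<rfloor> < int p" by (simp add: p_def)
      ultimately show False by linarith
    qed
    moreover have "(i, \<sigma> (k * p) i) \<in> used (k * p)"
      unfolding mem_used using kp by (intro exI[of _ "k * p"]) simp
    moreover have "used (Suc k * p) \<subseteq> used (k * p)"
      by (rule subrelI) (auto simp: mem_used dest: add_leD2)
    ultimately have "used (Suc k * p) \<subset> used (k * p)" by blast
    then have "card (used (Suc k * p)) < card (used (k * p))" by (rule psubset_card_mono[OF fin])
    with Suc show ?case by simp
  qed
  from this[of K] have card_used: "card (used (K * p)) \<le> CARD('n)"
    using card_pairs_ge by (simp add: K_def)
  \<comment> \<open>A graph alone already has \<open>CARD('n)\<close> pairs, so its inclusion in the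
    remaining set is an equality.\<close>
  have graph_eq: "graph (\<sigma> t) = used (K * p)" if "K * p \<le> t" "t \<le> s" for t
    using that card_used by (intro card_seteq[OF fin]) (auto simp: used_def card_graph)
  \<comment> \<open>As \<open>K * p < s\<close>, index \<open>Suc (K * p)\<close> still belongs to
    the run. Repeating the policy makes its value a fixed point of \<open>f\<close>, which
    \<open>run\<close> excludes.\<close>
  have "graph (\<sigma> (K * p)) = graph (\<sigma> (Suc (K * p)))" using Ks by (simp add: graph_eq)
  then have "\<sigma> (Suc (K * p)) = \<sigma> (K * p)" by (intro ext) (auto simp: set_eq_iff image_iff)
  then show False
    using runD[OF r, of "K * p"] Ks policy_map_val by simp
qed

section \<open>Termination of the transition system\<close>

lemma stops_from_run:
  assumes "run \<sigma> s"
  shows "stops_within (policies A) f (policy_map F) (s_max A lam) (Evaluate s (\<sigma> s))"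
  using assms
proof (induction "nat (s_max A lam) - s" arbitrary: \<sigma> s rule: less_induct)
  case less
  let ?step = "pi_step (policies A) f (policy_map F)"
  let ?stops = "stops_within (policies A) f (policy_map F) (s_max A lam)"
  have \<sigma>s: "\<sigma> s \<in> policies A" using runD(1)[OF less.prems] by simp
  have "?stops (Improve s (\<sigma> s) (val (\<sigma> s)))"
  proof (rule stops_within.running)
    obtain \<tau> where "\<tau> \<in> policies A" "f (val (\<sigma> s)) = policy_map F \<tau> (val (\<sigma> s))"
      by (rule min_map_attainedE)
    \<comment> \<open>The tie rule can be met: take \<open>\<sigma> s\<close> if it is itself
      greedy, and \<open>\<tau>\<close> otherwise.\<close>
    then show "\<exists>c'. ?step (Improve s (\<sigma> s) (val (\<sigma> s))) c'"
      using \<sigma>s by (metis pi_step.improve)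
  next
    fix c' assume "?step (Improve s (\<sigma> s) (val (\<sigma> s))) c'"
    then obtain \<sigma>' where \<sigma>': "\<sigma>' \<in> policies A" "f (val (\<sigma> s)) = policy_map F \<sigma>' (val (\<sigma> s))"
        "f (val (\<sigma> s)) = policy_map F (\<sigma> s) (val (\<sigma> s)) \<longrightarrow> \<sigma>' = \<sigma> s"
      and c': "c' = (if \<sigma>' = \<sigma> s then Stopped s (\<sigma> s) (val (\<sigma> s)) else Evaluate (Suc s) \<sigma>')"
      by cases auto
    show "?stops c'"
    proof (cases "\<sigma>' = \<sigma> s")
      case True
      then show ?thesis using c' run_length[OF less.prems] by (simp add: stops_within.stopped)
    next
      case False
      let ?\<sigma> = "\<sigma>(Suc s := \<sigma>')"
      \<comment> \<open>By the tie rule, \<open>\<sigma>' \<noteq> \<sigma> s\<close> means that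
        \<open>\<sigma> s\<close> is not greedy at its own value, so \<open>f\<close> does not fix
        \<open>val (\<sigma> s)\<close>.\<close>
      have "run ?\<sigma> (Suc s)"
        using less.prems \<sigma>' False policy_map_val[OF \<sigma>s]
        by (auto simp: run_def less_Suc_eq le_Suc_eq)
      \<comment> \<open>The longer run also obeys the bound, \<open>Suc s \<le> s_max A lam\<close>,
        so the truncated difference strictly decreases.\<close>
      moreover from run_length[OF this]
      have "nat (s_max A lam) - Suc s < nat (s_max A lam) - s" by linarith
      ultimately have "?stops (Evaluate (Suc s) (?\<sigma> (Suc s)))" by (intro less.hyps)
      then show ?thesis using c' False by simp
    qed
  qed
  \<comment> \<open>Uniqueness of the fixed point leaves exactly one successor.\<close>
  moreover have "?step (Evaluate s (\<sigma> s)) c' \<longleftrightarrow> c' = Improve s (\<sigma> s) (val (\<sigma> s))" for c'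
    using is_the_fixed_point_iff_val[OF \<sigma>s] by (auto intro: pi_step.evaluate elim: pi_step.cases)
  ultimately show ?case by (intro stops_within.running[of _ _ _ "Evaluate s (\<sigma> s)"]) auto
qed

lemma policy_iteration_stops:
  "policy_iteration_stops_within (policies A) f (policy_map F) (s_max A lam)"
  unfolding policy_iteration_stops_within_def
proof (rule stops_within.running)
  obtain \<sigma> where "\<sigma> \<in> policies A" by (rule min_map_attainedE)
  then show "\<exists>c'. pi_step (policies A) f (policy_map F) Start c'" by (metis pi_step.init)
next
  fix c' assume "pi_step (policies A) f (policy_map F) Start c'"
  then obtain \<sigma> where "\<sigma> \<in> policies A" "c' = Evaluate 0 \<sigma>" by cases auto
  then show "stops_within (policies A) f (policy_map F) (s_max A lam) c'"
    using stops_from_run[of "\<lambda>_. \<sigma>" 0] by (simp add: run_def)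
qed

end

theorem theorem5:
  fixes A :: "'n::finite \<Rightarrow> 'a set"
    and F :: "real ^ 'n \<Rightarrow> 'n \<Rightarrow> 'a \<Rightarrow> real"
    and lam :: real
  assumes "\<And>i. finite (A i)"
    and "\<And>i. A i \<noteq> {}"
    and "0 \<le> lam" and "lam < 1"
    and "\<And>\<sigma>. \<sigma> \<in> policies A \<Longrightarrow> mono (policy_map F \<sigma>)"
    and "\<And>\<sigma>. \<sigma> \<in> policies A \<Longrightarrow> sup_norm_contracting lam (policy_map F \<sigma>)"
  shows "policy_iteration_stops_within (policies A) (min_map A F) (policy_map F) (s_max A lam)"
proof -
  interpret contracting_policies A F lam
    using assms by unfold_locales
  show ?thesis by (rule policy_iteration_stops)
qed

end
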